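(* If $g$ is a Galois closure of a cover $f$, then $\deg g\le (\deg f)!$.
   Context: Let $\mathbf C$ be a category and $\mathbf D$ a full subcategory of $\mathbf C$. For arrows $f,g$ of $\mathbf C$ with ${\rm cod}\,f={\rm cod}\,g$, ${\rm Hom}(g,f)$ denotes the collection of all arrows $h$ of $\mathbf C$ with $g=f\circ h$. Standing assumptions: (G1) every diagram $B\to A\leftarrow C$ in $\mathbf D$ has a pullback in $\mathbf C$. (G2) (I) pushouts exist in $\mathbf D$; (II) every arrow of $\mathbf D$ is epic; (III) every monic arrow of $\mathbf D$ is an isomorphism whose inverse is an arrow of $\mathbf D$. (G3) for every object $U$ of $\mathbf C$ there is a set $\Sigma(U)$ of arrows $i$ of $\mathbf C$ with ${\rm dom}\,i$ in $\mathbf D$ and ${\rm cod}\,i=U$ such that for every arrow $u$ of $\mathbf C$ with ${\rm dom}\,u$ in $\mathbf D$ and ${\rm cod}\,u=U$ there is exactly one $i\in\Sigma(U)$ with ${\rm Hom}(u,i)\neq\emptyset$. (G4) there is a function $\deg$ from the collection of arrows of $\mathbf C$ whose codomain lies in $\mathbf D$ to the positive integers such that (I) $\deg(g\circ f)=\deg g\cdot\deg f$ whenever $f,g,g\circ f$ all lie in this collection; (II) $\deg f=\sum_{i\in\Sigma({\rm dom}\,f)}\deg(f\circ i)$ for every such $f$; (III) if $B\xrightarrow{f}A\xleftarrow{g}C$ is a diagram in $\mathbf D$ with pullback $B\xleftarrow{p}U\xrightarrow{q}C$, then $\deg f=\deg q$ and $\deg g=\deg p$. A cover is an arrow of $\mathbf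 D$. For a cover $f$, ${\rm Aut}(f)$ is the set of isomorphisms in ${\rm Hom}(f,f)$; $f$ is Galois if $|{\rm Aut}(f)|=\deg f$. Write $f\sqsubseteq g$ if ${\rm cod}\,f={\rm cod}\,g$ and ${\rm Hom}(g,f)\neq\emptyset$. A Galois closure of a cover $f$ is a cover $g$ which is Galois with $f\sqsubseteq g$ and such that $g\sqsubseteq h$ for every Galois cover $h$ with $f\sqsubseteq h\sqsubseteq g$. *)

theory Defs
  imports Complex_Main
begin

text \<open>
  Categories are given by explicit carriers of objects and arrows; the operations are total
  functions whose values matter on the carriers only, and \<open>Comp C g f\<close> (``g after f'')
  matters only if \<open>Dom C g = Cod C f\<close>.
\<close>

record ('o, 'a) cat =
  Obj :: "'o set"
  Arr :: "'a set"
  Dom :: "'a \<Rightarrow> 'o"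
  Cod :: "'a \<Rightarrow> 'o"
  Ide :: "'o \<Rightarrow> 'a"
  Comp :: "'a \<Rightarrow> 'a \<Rightarrow> 'a"

locale category =
  fixes C :: "('o, 'a) cat"
  assumes Dom_in_Obj: "f \<in> Arr C \<Longrightarrow> Dom C f \<in> Obj C"
    and Cod_in_Obj: "f \<in> Arr C \<Longrightarrow> Cod C f \<in> Obj C"
    and Ide_in_Arr: "A \<in> Obj C \<Longrightarrow> Ide C A \<in> Arr C"
    and Dom_Ide: "A \<in> Obj C \<Longrightarrow> Dom C (Ide C A) = A"
    and Cod_Ide: "A \<in> Obj C \<Longrightarrow> Cod C (Ide C A) = A"
    and Comp_in_Arr: "\<lbrakk>f \<in> Arr C; g \<in> Arr C; Dom C g = Cod C f\<rbrakk> \<Longrightarrow> Comp C g f \<in> Arr C"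
    and Dom_Comp: "\<lbrakk>f \<in> Arr C; g \<in> Arr C; Dom C g = Cod C f\<rbrakk> \<Longrightarrow> Dom C (Comp C g f) = Dom C f"
    and Cod_Comp: "\<lbrakk>f \<in> Arr C; g \<in> Arr C; Dom C g = Cod C f\<rbrakk> \<Longrightarrow> Cod C (Comp C g f) = Cod C g"
    and Comp_Ide: "f \<in> Arr C \<Longrightarrow> Comp C f (Ide C (Dom C f)) = f"
    and Ide_Comp: "f \<in> Arr C \<Longrightarrow> Comp C (Ide C (Cod C f)) f = f"
    and Comp_assoc:
      "\<lbrakk>f \<in> Arr C; g \<in> Arr C; h \<in> Arr C; Dom C g = Cod C f; Dom C h = Cod C g\<rbrakk>
        \<Longrightarrow> Comp C h (Comp C g f) = Comp C (Comp C h g) f"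

definition full_subcategory :: "('o, 'a) cat \<Rightarrow> ('o, 'a) cat \<Rightarrow> bool" where
  "full_subcategory D C \<longleftrightarrow>
    Obj D \<subseteq> Obj C \<and>
    D = C\<lparr>Obj := Obj D, Arr := {f \<in> Arr C. Dom C f \<in> Obj D \<and> Cod C f \<in> Obj D}\<rparr>"

definition monic :: "('o, 'a) cat \<Rightarrow> 'a \<Rightarrow> bool" where
  "monic C f \<longleftrightarrow> f \<in> Arr C \<and>
    (\<forall>u\<in>Arr C. \<forall>v\<in>Arr C.
      Dom C u = Dom C v \<and> Cod C u = Dom C f \<and> Cod C v = Dom C f \<and> Comp C f u = Comp C f v
        \<longrightarrow> u = v)"

definition epic :: "('o, 'a) cat \<Rightarrow> 'a \<Rightarrow> bool" where
  "epic C f \<longleftrightarrow> f \<in> Arr C \<and>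
    (\<forall>u\<in>Arr C. \<forall>v\<in>Arr C.
      Cod C u = Cod C v \<and> Dom C u = Cod C f \<and> Dom C v = Cod C f \<and> Comp C u f = Comp C v f
        \<longrightarrow> u = v)"

definition inverse_arrows :: "('o, 'a) cat \<Rightarrow> 'a \<Rightarrow> 'a \<Rightarrow> bool" where
  "inverse_arrows C f g \<longleftrightarrow>
    f \<in> Arr C \<and> g \<in> Arr C \<and> Dom C g = Cod C f \<and> Cod C g = Dom C f \<and>
    Comp C g f = Ide C (Dom C f) \<and> Comp C f g = Ide C (Cod C f)"

definition iso_arrow :: "('o, 'a) cat \<Rightarrow> 'a \<Rightarrow> bool" where
  "iso_arrow C f \<longleftrightarrow> (\<exists>g. inverse_arrows C f g)"

text \<open>
  \<open>is_pullback C f g p q\<close>: the span \<open>B \<leftarrow>p\<midarrow> U \<midarrow>q\<rightarrow> B'\<close> is a pullback of the cospan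
  \<open>B \<midarrow>f\<rightarrow> A \<leftarrow>g\<midarrow> B'\<close>. Dually for \<open>is_pushout C f g p q\<close>, where \<open>f\<close>, \<open>g\<close> is the span
  and \<open>p\<close>, \<open>q\<close> is the cospan.
\<close>

definition commuting_span :: "('o, 'a) cat \<Rightarrow> 'a \<Rightarrow> 'a \<Rightarrow> 'a \<Rightarrow> 'a \<Rightarrow> bool" where
  "commuting_span C f g p q \<longleftrightarrow>
    p \<in> Arr C \<and> q \<in> Arr C \<and> Dom C p = Dom C q \<and> Cod C p = Dom C f \<and> Cod C q = Dom C g \<and>
    Comp C f p = Comp C g q"

definition is_pullback :: "('o, 'a) cat \<Rightarrow> 'a \<Rightarrow> 'a \<Rightarrow> 'a \<Rightarrow> 'a \<Rightarrow> bool" where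
  "is_pullback C f g p q \<longleftrightarrow>
    f \<in> Arr C \<and> g \<in> Arr C \<and> Cod C f = Cod C g \<and> commuting_span C f g p q \<and>
    (\<forall>u v. commuting_span C f g u v \<longrightarrow>
      (\<exists>!w. w \<in> Arr C \<and> Dom C w = Dom C u \<and> Cod C w = Dom C p \<and>
            Comp C p w = u \<and> Comp C q w = v))"

definition commuting_cospan :: "('o, 'a) cat \<Rightarrow> 'a \<Rightarrow> 'a \<Rightarrow> 'a \<Rightarrow> 'a \<Rightarrow> bool" where
  "commuting_cospan C f g p q \<longleftrightarrow>
    p \<in> Arr C \<and> q \<in> Arr C \<and> Cod C p = Cod C q \<and> Dom C p = Cod C f \<and> Dom C q = Cod C g \<and>
    Comp C p f = Comp C q g"

definition is_pushout :: "('o, 'a) cat \<Rightarrow> 'a \<Rightarrow> 'a \<Rightarrow> 'a \<Rightarrow> 'a \<Rightarrow> bool" where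
  "is_pushout C f g p q \<longleftrightarrow>
    f \<in> Arr C \<and> g \<in> Arr C \<and> Dom C f = Dom C g \<and> commuting_cospan C f g p q \<and>
    (\<forall>u v. commuting_cospan C f g u v \<longrightarrow>
      (\<exists>!w. w \<in> Arr C \<and> Dom C w = Cod C p \<and> Cod C w = Cod C u \<and>
            Comp C w p = u \<and> Comp C w q = v))"

text \<open>\<open>HomOver C g f\<close> is the collection written Hom(g,f): arrows \<open>h\<close> with \<open>g = f \<circ> h\<close>.\<close>

definition HomOver :: "('o, 'a) cat \<Rightarrow> 'a \<Rightarrow> 'a \<Rightarrow> 'a set" where
  "HomOver C g f =
    {h \<in> Arr C. Dom C h = Dom C g \<and> Cod C h = Dom C f \<and> g = Comp C f h}"

text \<open>
  Epic, monic and pushout in (G2) are taken in the category \<open>D\<close>. The values of \<open>deg\<close> outside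
  the arrows with codomain in \<open>D\<close> are irrelevant. In (G4)(II) the sum over \<open>\<Sigma> (Dom C f)\<close> cannot
  be the default value 0 of a sum over an infinite set, because \<open>deg f\<close> is positive.
\<close>

locale galois_setting = category C
  for C :: "('o, 'a) cat" +
  fixes D :: "('o, 'a) cat"
    and \<Sigma> :: "'o \<Rightarrow> 'a set"
    and deg :: "'a \<Rightarrow> nat"
  assumes full: "full_subcategory D C"
    and G1: "\<lbrakk>f \<in> Arr D; g \<in> Arr D; Cod D f = Cod D g\<rbrakk> \<Longrightarrow> \<exists>p q. is_pullback C f g p q"
    and G2_I: "\<lbrakk>f \<in> Arr D; g \<in> Arr D; Dom D f = Dom D g\<rbrakk> \<Longrightarrow> \<exists>p q. is_pushout D f g p q"
    and G2_II: "f \<in> Arr D \<Longrightarrow> epic D f"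
    and G2_III: "monic D f \<Longrightarrow> \<exists>g \<in> Arr D. inverse_arrows C f g"
    and G3_arrows:
      "\<lbrakk>U \<in> Obj C; i \<in> \<Sigma> U\<rbrakk> \<Longrightarrow> i \<in> Arr C \<and> Dom C i \<in> Obj D \<and> Cod C i = U"
    and G3_unique:
      "\<lbrakk>U \<in> Obj C; u \<in> Arr C; Dom C u \<in> Obj D; Cod C u = U\<rbrakk>
        \<Longrightarrow> \<exists>!i. i \<in> \<Sigma> U \<and> HomOver C u i \<noteq> {}"
    and deg_pos: "\<lbrakk>f \<in> Arr C; Cod C f \<in> Obj D\<rbrakk> \<Longrightarrow> deg f > 0"
    and G4_I:
      "\<lbrakk>f \<in> Arr C; g \<in> Arr C; Dom C g = Cod C f; Cod C f \<in> Obj D; Cod C g \<in> Obj D\<rbrakk>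
        \<Longrightarrow> deg (Comp C g f) = deg g * deg f"
    and G4_II:
      "\<lbrakk>f \<in> Arr C; Cod C f \<in> Obj D\<rbrakk> \<Longrightarrow> deg f = (\<Sum>i\<in>\<Sigma> (Dom C f). deg (Comp C f i))"
    and G4_III:
      "\<lbrakk>f \<in> Arr D; g \<in> Arr D; Cod D f = Cod D g; is_pullback C f g p q\<rbrakk>
        \<Longrightarrow> deg f = deg q \<and> deg g = deg p"

definition is_cover :: "('o, 'a) cat \<Rightarrow> 'a \<Rightarrow> bool" where
  "is_cover D f \<longleftrightarrow> f \<in> Arr D"

definition Aut_cover :: "('o, 'a) cat \<Rightarrow> 'a \<Rightarrow> 'a set" where
  "Aut_cover C f = {h \<in> HomOver C f f. iso_arrow C h}"

text \<open>Since \<open>deg f > 0\<close>, the equation below also forces \<open>Aut_cover C f\<close> to be finite.\<close>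

definition galois_cover :: "('o, 'a) cat \<Rightarrow> ('o, 'a) cat \<Rightarrow> ('a \<Rightarrow> nat) \<Rightarrow> 'a \<Rightarrow> bool" where
  "galois_cover C D deg f \<longleftrightarrow> is_cover D f \<and> card (Aut_cover C f) = deg f"

text \<open>\<open>dominated C f g\<close> is the relation \<open>f \<sqsubseteq> g\<close>.\<close>

definition dominated :: "('o, 'a) cat \<Rightarrow> 'a \<Rightarrow> 'a \<Rightarrow> bool" where
  "dominated C f g \<longleftrightarrow> Cod C f = Cod C g \<and> HomOver C g f \<noteq> {}"

definition galois_closure ::
    "('o, 'a) cat \<Rightarrow> ('o, 'a) cat \<Rightarrow> ('a \<Rightarrow> nat) \<Rightarrow> 'a \<Rightarrow> 'a \<Rightarrow> bool" where
  "galois_closure C D deg f g \<longleftrightarrow>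
    galois_cover C D deg g \<and> dominated C f g \<and>
    (\<forall>h. galois_cover C D deg h \<and> dominated C f h \<and> dominated C h g \<longrightarrow> dominated C g h)"

end

theory Submission
  imports Defs "HOL-Combinatorics.Permutations"
begin

text \<open>
  Let \<open>G = Aut g\<close>. It acts on \<open>H = Hom(g,f)\<close> by precomposition, and \<open>H\<close> has at most \<open>deg f\<close>
  elements, so it suffices to show that the action is faithful. Quotients by subgroups need not
  exist in \<open>D\<close>, but the quotient by the kernel \<open>K\<close> of this action does: counting arrows out of
  the domain of \<open>g\<close> shows that two covers \<open>W\<^sub>1\<close>, \<open>W\<^sub>2\<close> dominated by \<open>g\<close> factor through a
  component \<open>W\<close> of a pullback whose stabiliser in \<open>G\<close> is the intersection of the stabilisers of
  \<open>W\<^sub>1\<close> and \<open>W\<^sub>2\<close>. Iterating over \<open>H\<close> gives \<open>g = h \<circ> W\<close> with \<open>f \<sqsubseteq> h\<close> and \<open>W\<close> of degree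
  \<open>|K|\<close>. As \<open>K\<close> is normal, \<open>h\<close> is Galois; hence \<open>g \<sqsubseteq> h\<close>, \<open>deg W = 1\<close> and \<open>K\<close> is trivial.
\<close>

section \<open>Arrows over a base, and covers\<close>

lemma HomOverI:
  "h \<in> Arr C \<Longrightarrow> Dom C h = Dom C g \<Longrightarrow> Cod C h = Dom C f \<Longrightarrow> Comp C f h = g \<Longrightarrow> h \<in> HomOver C g f"
  by (auto simp: HomOver_def)

lemma HomOverD:
  assumes "h \<in> HomOver C g f"
  shows "h \<in> Arr C" "Dom C h = Dom C g" "Cod C h = Dom C f" "Comp C f h = g"
  using assms by (auto simp: HomOver_def)

lemma (in category) HomOver_Comp:
  assumes "f \<in> Arr C" "a \<in> HomOver C g h" "w \<in> HomOver C h f"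
  shows "Comp C w a \<in> HomOver C g f"
  using HomOverD[OF assms(2)] HomOverD[OF assms(3)] assms(1)
  by (intro HomOverI) (simp_all add: Comp_in_Arr Dom_Comp Cod_Comp Comp_assoc)

lemma pullback_factor:
  assumes "is_pullback C f g p q" "commuting_span C f g u v"
  obtains w where "w \<in> Arr C" "Dom C w = Dom C u" "Cod C w = Dom C p"
    "Comp C p w = u" "Comp C q w = v"
proof -
  have "\<exists>!w. w \<in> Arr C \<and> Dom C w = Dom C u \<and> Cod C w = Dom C p \<and> Comp C p w = u \<and> Comp C q w = v"
    using assms unfolding is_pullback_def by blast
  then show thesis using that by blast
qed

context galois_setting
begin

lemma D_simps [simp]: "Dom D = Dom C" "Cod D = Cod C" "Comp D = Comp C" "Ide D = Ide C"
  and Arr_D: "f \<in> Arr D \<longleftrightarrow> f \<in> Arr C \<and> Dom C f \<in> Obj D \<and> Cod C f \<in> Obj D"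
proof -
  have D: "D = C\<lparr>Obj := Obj D, Arr := {f \<in> Arr C. Dom C f \<in> Obj D \<and> Cod C f \<in> Obj D}\<rparr>"
    using full unfolding full_subcategory_def by auto
  show "Dom D = Dom C" "Cod D = Cod C" "Comp D = Comp C" "Ide D = Ide C"
    by (subst D, simp)+
  show "f \<in> Arr D \<longleftrightarrow> f \<in> Arr C \<and> Dom C f \<in> Obj D \<and> Cod C f \<in> Obj D"
    by (subst D) simp
qed

lemma Comp_in_Arr_D:
  assumes "f \<in> Arr D" "g \<in> Arr D" "Dom C g = Cod C f"
  shows "Comp C g f \<in> Arr D"
  using assms by (simp add: Arr_D Comp_in_Arr Dom_Comp Cod_Comp)

lemma HomOver_in_Arr_D:
  assumes "f \<in> Arr D" "g \<in> Arr D" "h \<in> HomOver C g f"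
  shows "h \<in> Arr D"
  using assms by (auto simp: Arr_D HomOver_def)

lemma deg_HomOver:
  assumes "f \<in> Arr D" "g \<in> Arr D" "h \<in> HomOver C g f"
  shows "deg g = deg f * deg h"
proof -
  note h = HomOverD[OF assms(3)]
  have "deg (Comp C f h) = deg f * deg h"
    using h assms(1) by (intro G4_I) (auto simp: Arr_D)
  then show ?thesis using h by simp
qed

section \<open>Sections of covers and the size of Hom\<close>

text \<open>The section \<open>h\<close> can be cancelled on the left by means of \<open>r\<close>,
  so it is monic in \<open>D\<close> and \<open>G2_III\<close> gives it an inverse \<open>j\<close>.
  Then r = r (h j) = (r h) j = j.\<close>

lemma split_mono_inverse:
  assumes r: "r \<in> Arr D" and h: "h \<in> Arr D" "Cod C h = Dom C r" "Dom C h = Cod C r"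
    and rh: "Comp C r h = Ide C (Cod C r)"
  shows "Comp C h r = Ide C (Dom C r)"
proof -
  have "monic D h"
    unfolding monic_def
  proof (intro conjI ballI impI)
    fix u v
    assume uv: "u \<in> Arr D" "v \<in> Arr D"
      "Dom D u = Dom D v \<and> Cod D u = Dom D h \<and> Cod D v = Dom D h \<and> Comp D h u = Comp D h v"
    have cancel: "Comp C r (Comp C h w) = w" if "w \<in> Arr D" "Cod C w = Dom C h" for w
    proof -
      have "Comp C r (Comp C h w) = Comp C (Comp C r h) w"
        using that r h by (intro Comp_assoc) (auto simp: Arr_D)
      also have "\<dots> = w"
        using that h rh Ide_Comp[of w] by (simp add: Arr_D)
      finally show ?thesis .
    qed
    show "u = v" using uv cancel by (metis D_simps)
  qed (rule h(1))
  then obtain j where j: "j \<in> Arr D" "inverse_arrows C h j"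
    using G2_III by blast
  have jj: "j \<in> Arr C" "Dom C j = Cod C h" "Cod C j = Dom C h" "Comp C h j = Ide C (Cod C h)"
    using j(2) by (auto simp: inverse_arrows_def)
  have "r = Comp C r (Comp C h j)"
    using jj h r by (metis Comp_Ide Arr_D)
  also have "\<dots> = Comp C (Comp C r h) j"
    using jj h r by (intro Comp_assoc) (auto simp: Arr_D)
  also have "\<dots> = j"
    using jj h rh Ide_Comp by metis
  finally show ?thesis using jj h by simp
qed

text \<open>Arrows from \<open>g\<close> to \<open>f\<close> over the common codomain are sections of the pulled-back cover, and
  a section is determined by the component through which it factors.\<close>

lemma finite_HomOver_and_card_le:
  assumes f: "f \<in> Arr D" and g: "g \<in> Arr D" and cod: "Cod C f = Cod C g"
  shows "finite (HomOver C g f) \<and> card (HomOver C g f) \<le> deg f"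
proof -
  obtain p q where pb: "is_pullback C f g p q"
    using G1[OF f g] cod by auto
  define U where "U = Dom C q"
  have pq: "p \<in> Arr C" "q \<in> Arr C" "Dom C p = U" "Dom C q = U" "Cod C p = Dom C f"
      "Cod C q = Dom C g"
    using pb by (auto simp: is_pullback_def commuting_span_def U_def)
  have U: "U \<in> Obj C" using pq Dom_in_Obj by blast
  have qD: "Cod C q \<in> Obj D" using pq g by (simp add: Arr_D)
  \<comment> \<open>\<open>G4_III\<close> moves \<open>deg f\<close> to the pulled-back cover
    \<open>q\<close>, and \<open>G4_II\<close> distributes it over the components of
    \<open>U\<close>.\<close>
  have degq: "(\<Sum>i\<in>\<Sigma> U. deg (Comp C q i)) = deg f"
    using G4_II[OF pq(2) qD] G4_III[OF f g _ pb] cod pq by auto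
  have "deg f > 0" using f deg_pos by (auto simp: Arr_D)
  \<comment> \<open>Over an infinite index set the sum would default to 0, against
    \<open>deg f > 0\<close>.\<close>
  then have fin: "finite (\<Sigma> U)" using degq by (metis less_numeral_extra(3) sum.infinite)
  have i: "i \<in> Arr C" "Dom C i \<in> Obj D" "Cod C i = U" if "i \<in> \<Sigma> U" for i
    using G3_arrows[OF U that] by auto
  have qi: "Comp C q i \<in> Arr D" if "i \<in> \<Sigma> U" for i
    using i[OF that] pq qD by (simp add: Arr_D Comp_in_Arr Dom_Comp Cod_Comp)
  have "1 \<le> deg (Comp C q i)" if "i \<in> \<Sigma> U" for i
    using qi[OF that] deg_pos[of "Comp C q i"] by (auto simp: Arr_D)
  then have cardU: "card (\<Sigma> U) \<le> deg f"
    using sum_mono[of "\<Sigma> U" "\<lambda>_. 1" "\<lambda>i. deg (Comp C q i)"] degq by simp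
  \<comment> \<open>The component \<open>i\<close> admits a section \<open>h\<close> of the cover
    \<open>q i\<close> whose projection along \<open>p\<close> is \<open>x\<close>.\<close>
  define P where "P x i \<longleftrightarrow> i \<in> \<Sigma> U \<and> (\<exists>h\<in>Arr D. Dom C h = Dom C g \<and> Cod C h = Dom C i \<and>
      Comp C p (Comp C i h) = x \<and> Comp C q (Comp C i h) = Ide C (Dom C g))" for x i
  have ex: "\<exists>i. P x i" if x: "x \<in> HomOver C g f" for x
  proof -
    note x = HomOverD[OF x]
    \<comment> \<open>Pairing \<open>x\<close> with the identity turns it into a section of
      \<open>q\<close>; \<open>G3_unique\<close> then selects the component.\<close>
    have "commuting_span C f g x (Ide C (Dom C g))"
      using x g Dom_in_Obj
      by (auto simp: commuting_span_def Arr_D Ide_in_Arr Dom_Ide Cod_Ide Comp_Ide)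
    then obtain s where s: "s \<in> Arr C" "Dom C s = Dom C x" "Cod C s = U"
      "Comp C p s = x" "Comp C q s = Ide C (Dom C g)"
      using pullback_factor[OF pb] pq(3) by metis
    obtain i' h where ih: "i' \<in> \<Sigma> U" "h \<in> HomOver C s i'"
      using G3_unique[OF U s(1) _ s(3)] s x g by (auto simp: Arr_D)
    show ?thesis
      unfolding P_def using ih HomOverD[OF ih(2)] s x g i[OF ih(1)]
      by (intro exI[of _ i'] conjI bexI[of _ h]) (auto simp: Arr_D)
  qed
  have uniq: "x = y" if "P x i" "P y i" for x y i
  proof -
    obtain h where h: "h \<in> Arr D" "Dom C h = Dom C g" "Cod C h = Dom C i"
      "Comp C p (Comp C i h) = x" "Comp C q (Comp C i h) = Ide C (Dom C g)"
      and iU: "i \<in> \<Sigma> U" using \<open>P x i\<close> by (auto simp: P_def)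
    obtain h' where h': "h' \<in> Arr D" "Dom C h' = Dom C g" "Cod C h' = Dom C i"
      "Comp C p (Comp C i h') = y" "Comp C q (Comp C i h') = Ide C (Dom C g)"
      using \<open>P y i\<close> by (auto simp: P_def)
    let ?r = "Comp C q i"
    note i = i[OF iU]
    have r: "?r \<in> Arr D" "Dom C ?r = Dom C i" "Cod C ?r = Dom C g"
      using qi[OF iU] i pq by (auto simp: Dom_Comp Cod_Comp)
    have rh: "Comp C ?r h = Ide C (Dom C g)" "Comp C ?r h' = Ide C (Dom C g)"
      using h h' i pq by (auto simp: Arr_D Comp_assoc)
    \<comment> \<open>The section \<open>h\<close> of \<open>q i\<close> is a two-sided inverse, so
      any other section \<open>h'\<close> on the same component equals it.\<close>
    have "Comp C h ?r = Ide C (Dom C i)"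
      using split_mono_inverse[of ?r h] r h rh by simp
    then have "h' = Comp C (Comp C h ?r) h'"
      using h' Ide_Comp by (metis Arr_D)
    also have "\<dots> = Comp C h (Comp C ?r h')"
      using h h' r by (simp add: Arr_D Comp_assoc)
    also have "\<dots> = h"
      using rh h Comp_Ide by (metis Arr_D)
    finally show ?thesis using h h' by simp
  qed
  define c where "c x = (SOME i. P x i)" for x
  have c: "P x (c x)" if "x \<in> HomOver C g f" for x
    unfolding c_def using ex[OF that] by (rule someI_ex)
  have inj: "inj_on c (HomOver C g f)"
    using c uniq by (metis inj_onI)
  have sub: "c ` HomOver C g f \<subseteq> \<Sigma> U"
    using c by (auto simp: P_def)
  have "finite (HomOver C g f)" using inj sub fin by (metis inj_on_finite)
  moreover have "card (HomOver C g f) \<le> card (\<Sigma> U)" using card_inj_on_le[OF inj sub fin] .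
  ultimately show ?thesis using cardU by simp
qed

lemmas finite_HomOver = finite_HomOver_and_card_le[THEN conjunct1]
lemmas card_HomOver_le = finite_HomOver_and_card_le[THEN conjunct2]

text \<open>If \<open>m u = m v\<close>, then \<open>u\<close> and \<open>v\<close> both lie in
  Hom(m u, m), which has at most \<open>deg m = 1\<close> element. So \<open>m\<close> is monic in
  \<open>D\<close> and \<open>G2_III\<close> applies.\<close>

lemma deg_1_iso:
  assumes m: "m \<in> Arr D" "deg m = 1"
  shows "\<exists>n \<in> Arr D. inverse_arrows C m n"
proof (rule G2_III, unfold monic_def, intro conjI ballI impI)
  fix u v
  assume uv: "u \<in> Arr D" "v \<in> Arr D"
    "Dom D u = Dom D v \<and> Cod D u = Dom D m \<and> Cod D v = Dom D m \<and> Comp D m u = Comp D m v"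
  let ?H = "HomOver C (Comp C m u) m"
  have mu: "Comp C m u \<in> Arr D" "Cod C m = Cod C (Comp C m u)"
    using uv m Comp_in_Arr_D[OF uv(1) m(1)] Cod_Comp[of u m] by (auto simp: Arr_D[of u] Arr_D[of m])
  have "u \<in> ?H" "v \<in> ?H"
    using uv m by (auto intro!: HomOverI simp: Arr_D Dom_Comp)
  moreover have "finite ?H" "card ?H \<le> Suc 0"
    using finite_HomOver_and_card_le[OF m(1) mu] m by auto
  ultimately show "u = v"
    by (auto simp: card_le_Suc0_iff_eq)
qed (rule m(1))

section \<open>Orbits and stabilisers of the automorphisms of a Galois cover\<close>

text \<open>The stabiliser of \<open>w\<close> under precomposition. It is formed in Hom(g,g), which
  is the group Aut(g) once \<open>g\<close> is Galois.\<close>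

definition stab :: "'a \<Rightarrow> 'a \<Rightarrow> 'a set" where
  "stab g w = {c \<in> HomOver C g g. Comp C w c = w}"

text \<open>Aut(g) has \<open>deg g\<close> elements and sits inside Hom(g,g), which has at most
  that many.\<close>

lemma Aut_cover_galois:
  assumes "galois_cover C D deg g"
  shows "Aut_cover C g = HomOver C g g" and "card (HomOver C g g) = deg g"
proof -
  have g: "g \<in> Arr D" "card (Aut_cover C g) = deg g"
    using assms by (auto simp: galois_cover_def is_cover_def)
  have sub: "Aut_cover C g \<subseteq> HomOver C g g" by (auto simp: Aut_cover_def)
  show eq: "Aut_cover C g = HomOver C g g"
    using card_seteq[OF finite_HomOver[OF g(1) g(1) refl] sub] card_HomOver_le[OF g(1) g(1) refl] g
    by simp
  show "card (HomOver C g g) = deg g" using eq g by simp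
qed

lemma galois_inverse:
  assumes "galois_cover C D deg g" "a \<in> HomOver C g g"
  obtains b where "b \<in> HomOver C g g" "Comp C a b = Ide C (Dom C g)" "Comp C b a = Ide C (Dom C g)"
proof -
  have g: "g \<in> Arr C" using assms by (auto simp: galois_cover_def is_cover_def Arr_D)
  note a = HomOverD[OF assms(2)]
  obtain b where b: "inverse_arrows C a b"
    using assms Aut_cover_galois[OF assms(1)] by (auto simp: Aut_cover_def iso_arrow_def)
  have bb: "b \<in> Arr C" "Dom C b = Dom C g" "Cod C b = Dom C g"
      "Comp C a b = Ide C (Dom C g)" "Comp C b a = Ide C (Dom C g)"
    using b a by (auto simp: inverse_arrows_def)
  have "Comp C g b = Comp C (Comp C g a) b" using a by simp
  also have "\<dots> = Comp C g (Comp C a b)"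
    using a bb g by (intro Comp_assoc[symmetric]) auto
  also have "\<dots> = g" using bb g Comp_Ide by simp
  finally show thesis using that[of b] bb by (auto intro: HomOverI)
qed

text \<open>Orbit counting: the orbit of \<open>W\<close> lies in Hom(g,h) and has at most
  \<open>deg h\<close> elements, and its stabiliser has at most \<open>deg W\<close>. Since |Aut(g)|
  = \<open>deg g\<close> = \<open>deg h * deg W\<close>, both bounds are attained, and the action on
  Hom(g,h) is transitive.\<close>

lemma card_HomOver_galois:
  assumes gal: "galois_cover C D deg g" and h: "h \<in> Arr D" and W: "W \<in> HomOver C g h"
  shows "card (HomOver C g h) = deg h" "card (stab g W) = deg W"
    "(\<lambda>a. Comp C W a) ` HomOver C g g = HomOver C g h"
proof -
  let ?G = "HomOver C g g" and ?H = "HomOver C g h"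
  have g: "g \<in> Arr D" using gal by (auto simp: galois_cover_def is_cover_def)
  have gC: "g \<in> Arr C" "h \<in> Arr C" using g h by (auto simp: Arr_D)
  note w = HomOverD[OF W]
  have WD: "W \<in> Arr D" using HomOver_in_Arr_D[OF h g W] .
  have cod: "Cod C h = Cod C g" using w gC Cod_Comp by metis
  have finH: "finite ?H" and cardH: "card ?H \<le> deg h"
    using finite_HomOver_and_card_le[OF h g cod] by auto
  have finG: "finite ?G" using finite_HomOver[OF g g refl] .
  \<comment> \<open>An arrow \<open>c\<close> with \<open>W c = W\<close> is an endomorphism of the
    cover \<open>W\<close>, so the bound on Hom(W,W) applies.\<close>
  have stab_sub: "stab g W \<subseteq> HomOver C W W"
    using w by (auto simp: stab_def HomOver_def)
  have finS: "finite (stab g W)" using finG by (auto simp: stab_def)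
  have "card (stab g W) \<le> card (HomOver C W W)"
    using card_mono[OF finite_HomOver[OF WD WD refl] stab_sub] .
  then have cardS: "card (stab g W) \<le> deg W"
    using card_HomOver_le[OF WD WD refl] by simp
  let ?I = "(\<lambda>a. Comp C W a) ` ?G"
  have sub: "?I \<subseteq> ?H" using HomOver_Comp[OF gC(2) _ W] by auto
  \<comment> \<open>The fibre over \<open>W b\<close> embeds into the stabiliser by composing with
    the inverse of \<open>b\<close> on the right.\<close>
  have fib: "card {a \<in> ?G. Comp C W a = y} \<le> card (stab g W)" if "y \<in> ?I" for y
  proof -
    obtain b where b: "b \<in> ?G" "y = Comp C W b" using \<open>y \<in> ?I\<close> by auto
    obtain b' where b': "b' \<in> ?G" "Comp C b b' = Ide C (Dom C g)" "Comp C b' b = Ide C (Dom C g)"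
      using galois_inverse[OF gal b(1)] .
    note B = HomOverD[OF b(1)] and B' = HomOverD[OF b'(1)]
    have inj: "inj_on (\<lambda>a. Comp C a b') {a \<in> ?G. Comp C W a = y}"
    proof (rule inj_on_inverseI[where g = "\<lambda>a. Comp C a b"])
      fix a assume "a \<in> {a \<in> ?G. Comp C W a = y}"
      then have "a \<in> ?G" by simp
      note a = HomOverD[OF this]
      show "Comp C (Comp C a b') b = a"
        using a B B' b' by (simp add: Comp_assoc[symmetric]) (metis Comp_Ide)
    qed
    have "(\<lambda>a. Comp C a b') ` {a \<in> ?G. Comp C W a = y} \<subseteq> stab g W"
    proof (intro image_subsetI)
      fix a assume "a \<in> {a \<in> ?G. Comp C W a = y}"
      then have aG: "a \<in> ?G" and ay: "Comp C W a = Comp C W b" using b by auto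
      note a = HomOverD[OF aG]
      have "Comp C W (Comp C a b') = Comp C (Comp C W a) b'"
        using a w B' by (simp add: Comp_assoc)
      also have "\<dots> = Comp C W (Comp C b b')"
        unfolding ay using B w B' by (simp add: Comp_assoc)
      also have "\<dots> = W" using b' w Comp_Ide by metis
      finally show "Comp C a b' \<in> stab g W"
        using HomOver_Comp[OF gC(1) b'(1) aG] by (simp add: stab_def)
    qed
    from card_inj_on_le[OF inj this finS] show ?thesis .
  qed
  have "?G = (\<Union>y\<in>?I. {a \<in> ?G. Comp C W a = y})" by auto
  then have "card ?G \<le> (\<Sum>y\<in>?I. card {a \<in> ?G. Comp C W a = y})"
    using card_UN_le[of ?I "\<lambda>y. {a \<in> ?G. Comp C W a = y}"] finG by simp
  also have "\<dots> \<le> card ?I * card (stab g W)"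
    using sum_bounded_above[OF fib] by simp
  finally have le: "deg h * deg W \<le> card ?I * card (stab g W)"
    using Aut_cover_galois(2)[OF gal] deg_HomOver[OF h g W] by simp
  have pos: "deg h > 0" "deg W > 0" using h WD deg_pos by (auto simp: Arr_D)
  have cI: "card ?I \<le> card ?H" using card_mono[OF finH sub] .
  have 1: "card ?I = deg h"
  proof (rule ccontr)
    assume "card ?I \<noteq> deg h"
    then have "card ?I < deg h" using cI cardH by linarith
    then have "card ?I * card (stab g W) < deg h * deg W"
      using cardS pos by (metis mult_le_mono2 mult_less_mono1 order_le_less_trans)
    with le show False by simp
  qed
  then have "deg W \<le> card (stab g W)" using le pos by simp
  then show "card (stab g W) = deg W" using cardS by simp
  show H: "card ?H = deg h" using 1 cI cardH by simp
  show "?I = ?H" using card_seteq[OF finH sub] 1 H by simp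
qed

section \<open>Common refinements of covers below a Galois cover\<close>

text \<open>The \<open>deg h\<^sub>1 * deg h\<^sub>2\<close> pairs of arrows from \<open>g\<close> to \<open>h\<^sub>1\<close> and \<open>h\<^sub>2\<close> all factor through
  components of the pullback, and the arrows from \<open>g\<close> to these components number at most
  \<open>deg h\<^sub>1 * deg h\<^sub>2\<close>. So each pair factors in exactly one way.\<close>

lemma common_refinement:
  assumes gal: "galois_cover C D deg g" and h1: "h1 \<in> Arr D" and h2: "h2 \<in> Arr D"
    and W1: "W1 \<in> HomOver C g h1" and W2: "W2 \<in> HomOver C g h2"
  obtains h W m1 m2 where "h \<in> Arr D" "W \<in> HomOver C g h"
    "m1 \<in> HomOver C h h1" "m2 \<in> HomOver C h h2" "Comp C m1 W = W1" "Comp C m2 W = W2"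
    "stab g W = stab g W1 \<inter> stab g W2"
proof -
  have g: "g \<in> Arr D" using gal by (auto simp: galois_cover_def is_cover_def)
  have hC: "g \<in> Arr C" "h1 \<in> Arr C" "h2 \<in> Arr C" using g h1 h2 by (auto simp: Arr_D)
  have cod: "Cod C h1 = Cod C g" "Cod C h2 = Cod C g"
    using HomOverD[OF W1] HomOverD[OF W2] hC Cod_Comp by metis+
  obtain p q where pb: "is_pullback C h1 h2 p q"
    using G1[OF h1 h2] cod by auto
  define U where "U = Dom C q"
  have pq: "p \<in> Arr C" "q \<in> Arr C" "Dom C p = U" "Dom C q = U" "Cod C p = Dom C h1"
      "Cod C q = Dom C h2" "Comp C h1 p = Comp C h2 q"
    using pb by (auto simp: is_pullback_def commuting_span_def U_def)
  have U: "U \<in> Obj C" using pq Dom_in_Obj by blast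
  have pD: "Cod C p \<in> Obj D" and qD: "Cod C q \<in> Obj D" using pq h1 h2 by (auto simp: Arr_D)
  have degp: "(\<Sum>i\<in>\<Sigma> U. deg (Comp C p i)) = deg h2"
    using G4_II[OF pq(1) pD] G4_III[OF h1 h2 _ pb] cod pq by auto
  have "deg h2 > 0" using h2 deg_pos by (auto simp: Arr_D)
  then have fin: "finite (\<Sigma> U)" using degp by (metis less_numeral_extra(3) sum.infinite)
  have i: "i \<in> Arr C" "Dom C i \<in> Obj D" "Cod C i = U" if "i \<in> \<Sigma> U" for i
    using G3_arrows[OF U that] by auto
  have pi: "Comp C p i \<in> Arr D" "Comp C q i \<in> Arr D" "Dom C (Comp C p i) = Dom C i"
      "Dom C (Comp C q i) = Dom C i" "Cod C (Comp C p i) = Dom C h1" "Cod C (Comp C q i) = Dom C h2"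
    if "i \<in> \<Sigma> U" for i
    using i[OF that] pq pD qD by (simp_all add: Arr_D Comp_in_Arr Dom_Comp Cod_Comp)
  \<comment> \<open>The component \<open>i\<close> of the pullback, regarded as a cover of the
    common base.\<close>
  define k where "k i = Comp C h1 (Comp C p i)" for i
  have k: "k i \<in> Arr D" "Dom C (k i) = Dom C i" "Cod C (k i) = Cod C g"
      "Comp C h2 (Comp C q i) = k i" "deg (k i) = deg h1 * deg (Comp C p i)" if "i \<in> \<Sigma> U" for i
  proof -
    note P = pi[OF that] and I = i[OF that]
    show "k i \<in> Arr D" unfolding k_def using P h1 by (intro Comp_in_Arr_D[OF P(1) h1]) auto
    show "Dom C (k i) = Dom C i" "Cod C (k i) = Cod C g"
      unfolding k_def using P hC cod by (simp_all add: Arr_D Dom_Comp Cod_Comp)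
    show "Comp C h2 (Comp C q i) = k i"
      unfolding k_def using I pq hC by (simp add: Comp_assoc)
    show "deg (k i) = deg h1 * deg (Comp C p i)"
      unfolding k_def using P h1 by (intro G4_I) (auto simp: Arr_D)
  qed
  have m: "Comp C p i \<in> HomOver C (k i) h1" "Comp C q i \<in> HomOver C (k i) h2" if "i \<in> \<Sigma> U" for i
    using k[OF that] pi[OF that] by (auto intro!: HomOverI simp: Arr_D k_def)
  let ?T = "SIGMA i:\<Sigma> U. HomOver C g (k i)"
  let ?P = "HomOver C g h1 \<times> HomOver C g h2"
  define \<phi> where "\<phi> = (\<lambda>(i, w). (Comp C (Comp C p i) w, Comp C (Comp C q i) w))"
  have finT: "finite ?T"
    using fin by (intro finite_SigmaI finite_HomOver[OF k(1) g k(3)])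
  have "card ?T = (\<Sum>i\<in>\<Sigma> U. card (HomOver C g (k i)))"
    using fin by (intro card_SigmaI ballI finite_HomOver[OF k(1) g k(3)])
  also have "\<dots> \<le> (\<Sum>i\<in>\<Sigma> U. deg h1 * deg (Comp C p i))"
    using card_HomOver_le[OF k(1) g k(3)] k(5) by (intro sum_mono) metis
  also have "\<dots> = deg h1 * deg h2"
    using degp by (simp flip: sum_distrib_left)
  also have "\<dots> = card ?P"
    using card_HomOver_galois(1)[OF gal h1 W1] card_HomOver_galois(1)[OF gal h2 W2]
    by (simp add: card_cartesian_product)
  finally have cardT: "card ?T \<le> card ?P" .
  \<comment> \<open>The pullback property turns a pair into an arrow to \<open>U\<close>, and
    \<open>G3_unique\<close> factors that arrow through a component.\<close>
  have surj: "?P \<subseteq> \<phi> ` ?T"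
  proof
    fix y assume "y \<in> ?P"
    then obtain y1 y2 where y: "y = (y1, y2)" "y1 \<in> HomOver C g h1" "y2 \<in> HomOver C g h2"
      by blast
    note y1 = HomOverD[OF y(2)] and y2 = HomOverD[OF y(3)]
    have "commuting_span C h1 h2 y1 y2"
      using y1 y2 by (auto simp: commuting_span_def)
    then obtain s where s: "s \<in> Arr C" "Dom C s = Dom C y1" "Cod C s = U"
      "Comp C p s = y1" "Comp C q s = y2"
      using pullback_factor[OF pb] pq(3) by metis
    obtain j w where jw: "j \<in> \<Sigma> U" "w \<in> HomOver C s j"
      using G3_unique[OF U s(1) _ s(3)] s y1 g by (auto simp: Arr_D)
    note J = i[OF jw(1)] and w = HomOverD[OF jw(2)]
    have eq: "Comp C (Comp C p j) w = y1" "Comp C (Comp C q j) w = y2"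
      using J w pq s by (simp_all flip: Comp_assoc)
    have "Comp C (k j) w = g"
      using eq y1 w pi[OF jw(1)] hC by (simp add: k_def Arr_D flip: Comp_assoc)
    then have "w \<in> HomOver C g (k j)"
      using w k[OF jw(1)] s y1 by (auto intro: HomOverI)
    with jw eq y(1) show "y \<in> \<phi> ` ?T"
      by (intro image_eqI[of _ _ "(j, w)"]) (auto simp: \<phi>_def)
  qed
  \<comment> \<open>Surjectivity onto \<open>?P\<close> and \<open>card ?T \<le> card ?P\<close>
    together force \<open>\<phi>\<close> to be injective.\<close>
  have "card (\<phi> ` ?T) = card ?T"
    using cardT card_mono[OF finite_imageI[OF finT] surj] card_image_le[OF finT, of \<phi>] by linarith
  then have inj: "inj_on \<phi> ?T" using eq_card_imp_inj_on[OF finT] by blast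
  have "(W1, W2) \<in> \<phi> ` ?T" using surj W1 W2 by blast
  then obtain j W where jW: "j \<in> \<Sigma> U" "W \<in> HomOver C g (k j)"
    "Comp C (Comp C p j) W = W1" "Comp C (Comp C q j) W = W2"
    by (auto simp: \<phi>_def)
  note w = HomOverD[OF jW(2)]
  have assoc: "Comp C (Comp C p j) (Comp C W c) = Comp C W1 c"
      "Comp C (Comp C q j) (Comp C W c) = Comp C W2 c" if "c \<in> HomOver C g g" for c
    using HomOverD[OF that] w pi[OF jW(1)] k[OF jW(1)] jW by (simp_all add: Arr_D Comp_assoc)
  have st: "stab g W = stab g W1 \<inter> stab g W2"
  proof
    show "stab g W \<subseteq> stab g W1 \<inter> stab g W2"
    proof
      fix c assume "c \<in> stab g W"
      then have "c \<in> HomOver C g g" "Comp C W c = W" by (auto simp: stab_def)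
      then have "Comp C W1 c = W1" "Comp C W2 c = W2"
        using assoc[of c] jW(3,4) by metis+
      with \<open>c \<in> HomOver C g g\<close> show "c \<in> stab g W1 \<inter> stab g W2"
        by (simp add: stab_def)
    qed
    show "stab g W1 \<inter> stab g W2 \<subseteq> stab g W"
    proof
      fix c assume "c \<in> stab g W1 \<inter> stab g W2"
      then have c: "c \<in> HomOver C g g" "Comp C W1 c = W1" "Comp C W2 c = W2"
        by (auto simp: stab_def)
      have "Comp C W c \<in> HomOver C g (k j)"
        using HomOver_Comp[OF _ c(1) jW(2)] k[OF jW(1)] by (simp add: Arr_D)
      \<comment> \<open>An arrow \<open>c\<close> fixing \<open>W1\<close> and \<open>W2\<close>
        leaves the pair unchanged, so injectivity gives \<open>W c = W\<close>.\<close>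
      moreover have "\<phi> (j, Comp C W c) = \<phi> (j, W)"
        using assoc[OF c(1)] c jW by (simp add: \<phi>_def)
      ultimately have "Comp C W c = W"
        using inj jW by (auto dest: inj_onD)
      with c show "c \<in> stab g W" by (simp add: stab_def)
    qed
  qed
  show thesis
    using that[OF k(1)[OF jW(1)] jW(2) m[OF jW(1)] jW(3,4) st] .
qed

text \<open>Iteration of \<open>common_refinement\<close> over \<open>S\<close>. The element
  \<open>x0\<close>, with \<open>f\<close> itself as cover, starts the induction and keeps the
  intersection nonempty-indexed; at each later step \<open>m2\<close> supplies the arrow from the
  new cover to \<open>f\<close>.\<close>

lemma refinement_of_finite_set:
  assumes gal: "galois_cover C D deg g" and f: "f \<in> Arr D" and x0: "x0 \<in> HomOver C g f"
    and S: "finite S" "S \<subseteq> HomOver C g f"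
  shows "\<exists>h W. h \<in> Arr D \<and> W \<in> HomOver C g h \<and> HomOver C h f \<noteq> {} \<and>
    stab g W = (\<Inter>x\<in>insert x0 S. stab g x)"
  using S
proof (induction S)
  case empty
  have "Ide C (Dom C f) \<in> HomOver C f f"
    using f by (auto intro!: HomOverI simp: Arr_D Ide_in_Arr Dom_Ide Cod_Ide Comp_Ide Dom_in_Obj)
  then show ?case using f x0 by (intro exI[of _ f] exI[of _ x0]) auto
next
  case (insert x S)
  then obtain h1 W1 where 1: "h1 \<in> Arr D" "W1 \<in> HomOver C g h1" "HomOver C h1 f \<noteq> {}"
    "stab g W1 = (\<Inter>x\<in>insert x0 S. stab g x)" by auto
  have x: "x \<in> HomOver C g f" using insert by simp
  obtain h W m1 m2 where h: "h \<in> Arr D" "W \<in> HomOver C g h" "m2 \<in> HomOver C h f"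
    "stab g W = stab g W1 \<inter> stab g x"
    using common_refinement[OF gal 1(1) f 1(2) x] by metis
  then show ?case using 1(4) by (intro exI[of _ h] exI[of _ W]) auto
qed

section \<open>The quotient by the kernel of the action\<close>

text \<open>The stabiliser of \<open>W a\<close> is the conjugate of that of \<open>W\<close> by
  \<open>a\<close>, so the last hypothesis is normality. Under it every arrow \<open>W a\<close> has
  the form \<open>s W\<close> with \<open>s\<close> in Aut(h); as Hom(g,h) has \<open>deg h\<close>
  elements, Aut(h) is large enough.\<close>

lemma normal_stab_galois:
  assumes gal: "galois_cover C D deg g" and h: "h \<in> Arr D" and W: "W \<in> HomOver C g h"
    and normal: "\<And>a. a \<in> HomOver C g g \<Longrightarrow> stab g W \<subseteq> stab g (Comp C W a)"
  shows "galois_cover C D deg h"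
proof -
  have g: "g \<in> Arr D" using gal by (auto simp: galois_cover_def is_cover_def)
  have hC: "g \<in> Arr C" "h \<in> Arr C" using g h by (auto simp: Arr_D)
  have pos: "deg u > 0" if "u \<in> Arr D" for u using that deg_pos by (auto simp: Arr_D)
  have "HomOver C g h \<subseteq> (\<lambda>s. Comp C s W) ` Aut_cover C h"
  proof
    fix y assume y: "y \<in> HomOver C g h"
    then obtain a where a: "a \<in> HomOver C g g" "y = Comp C W a"
      using card_HomOver_galois(3)[OF gal h W] by blast
    obtain h' V m1 m2 where V: "h' \<in> Arr D" "V \<in> HomOver C g h'" "m1 \<in> HomOver C h' h"
      "m2 \<in> HomOver C h' h" "Comp C m1 V = y" "Comp C m2 V = W"
      "stab g V = stab g y \<inter> stab g W"
      using common_refinement[OF gal h h y W] .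
    note v = HomOverD[OF V(2)] and M1 = HomOverD[OF V(3)] and M2 = HomOverD[OF V(4)]
    \<comment> \<open>By normality the stabiliser of \<open>y\<close> contains that of
      \<open>W\<close>, so the intersection collapses.\<close>
    have st: "stab g V = stab g W" using V(7) normal[OF a(1)] a(2) by auto
    have mD: "m2 \<in> Arr D" using HomOver_in_Arr_D[OF h V(1,4)] .
    have VD: "V \<in> Arr D" using HomOver_in_Arr_D[OF V(1) g V(2)] .
    have "deg W = deg V"
      using card_HomOver_galois(2)[OF gal V(1,2)] card_HomOver_galois(2)[OF gal h W] st by simp
    moreover have "deg W = deg m2 * deg V"
    proof -
    have "deg (Comp C m2 V) = deg m2 * deg V"
      using v M2 mD VD by (intro G4_I) (auto simp: Arr_D)
    then show ?thesis using V(6) by simp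
  qed
    \<comment> \<open>Degrees equal orders of stabilisers, so \<open>V\<close> and \<open>W\<close>
      have the same degree and \<open>m2\<close> becomes invertible. Then \<open>m1 n\<close>
      carries \<open>W\<close> to \<open>y\<close>, where \<open>n\<close> inverts
      \<open>m2\<close>.\<close>
    ultimately have "deg m2 = 1" using pos[OF VD] by simp
    then obtain n where n: "n \<in> Arr D" "inverse_arrows C m2 n"
      using deg_1_iso mD by blast
    have N: "n \<in> Arr C" "Dom C n = Dom C h" "Cod C n = Dom C h'"
      "Comp C n m2 = Ide C (Dom C h')" "Comp C m2 n = Ide C (Dom C h)"
      using n(2) M2 by (auto simp: inverse_arrows_def)
    have "Comp C h' n = Comp C h (Comp C m2 n)"
      using M2 N hC by (metis Comp_assoc)
    then have "n \<in> HomOver C h h'"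
      using N hC by (auto intro!: HomOverI simp: Comp_Ide)
    then have s: "Comp C m1 n \<in> HomOver C h h"
      using HomOver_Comp[OF hC(2)] V(3) by blast
    have sD: "Comp C m1 n \<in> Arr D" using HomOver_in_Arr_D[OF h h s] .
    \<comment> \<open>Multiplicativity of \<open>deg\<close> gives every endomorphism of
      \<open>h\<close> degree 1, which makes it invertible.\<close>
    have "deg (Comp C m1 n) = 1" using deg_HomOver[OF h h s] pos[OF h] by simp
    then have "Comp C m1 n \<in> Aut_cover C h"
      using deg_1_iso[OF sD] s by (auto simp: Aut_cover_def iso_arrow_def)
    moreover have "Comp C (Comp C m1 n) W = y"
    proof -
      have "Comp C n W = Comp C (Comp C n m2) V"
        using V(6) N M2 v by (metis Comp_assoc)
      also have "\<dots> = V" using N v Ide_Comp by metis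
      finally show ?thesis
        using V(5) N M1 HomOverD[OF W] by (metis Comp_assoc)
    qed
    ultimately show "y \<in> (\<lambda>s. Comp C s W) ` Aut_cover C h" by blast
  qed
  moreover have fin: "finite (Aut_cover C h)"
    using finite_HomOver[OF h h refl] by (auto simp: Aut_cover_def)
  ultimately have "deg h \<le> card (Aut_cover C h)"
    using card_HomOver_galois(1)[OF gal h W] surj_card_le by metis
  moreover have "card (Aut_cover C h) \<le> card (HomOver C h h)"
    using finite_HomOver[OF h h refl] by (intro card_mono) (auto simp: Aut_cover_def)
  ultimately show ?thesis
    using card_HomOver_le[OF h h refl] h by (simp add: galois_cover_def is_cover_def)
qed

text \<open>Faithfulness of the action on Hom(g,f). Only here does the minimality in
  \<open>galois_closure\<close> enter: the quotient of \<open>g\<close> by the kernel is a Galois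
  cover between \<open>f\<close> and \<open>g\<close>.\<close>

lemma galois_closure_trivial_kernel:
  assumes cl: "galois_closure C D deg f g" and f: "f \<in> Arr D"
  shows "(\<Inter>x\<in>HomOver C g f. stab g x) = {Ide C (Dom C g)}"
proof -
  have gal: "galois_cover C D deg g" and dom: "dominated C f g"
    using cl by (auto simp: galois_closure_def)
  have g: "g \<in> Arr D" using gal by (auto simp: galois_cover_def is_cover_def)
  have gC: "g \<in> Arr C" "f \<in> Arr C" using g f by (auto simp: Arr_D)
  have cod: "Cod C f = Cod C g" using dom by (simp add: dominated_def)
  have fin: "finite (HomOver C g f)" using finite_HomOver[OF f g cod] .
  obtain x0 where x0: "x0 \<in> HomOver C g f" using dom by (auto simp: dominated_def)
  let ?K = "\<Inter>x\<in>HomOver C g f. stab g x"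
  obtain h W where h: "h \<in> Arr D" and W: "W \<in> HomOver C g h" and hf: "HomOver C h f \<noteq> {}"
    and st: "stab g W = ?K"
    using refinement_of_finite_set[OF gal f x0 fin order_refl] x0 by (auto simp: insert_absorb)
  note w = HomOverD[OF W]
  have hC: "h \<in> Arr C" using h by (simp add: Arr_D)
  have "stab g W \<subseteq> stab g (Comp C W a)" if a: "a \<in> HomOver C g g" for a
  proof
    fix c assume c: "c \<in> stab g W"
    then have cG: "c \<in> HomOver C g g" by (simp add: stab_def)
    obtain b where b: "b \<in> HomOver C g g" "Comp C a b = Ide C (Dom C g)"
      "Comp C b a = Ide C (Dom C g)"
      using galois_inverse[OF gal a] .
    note A = HomOverD[OF a] and B = HomOverD[OF b(1)] and c' = HomOverD[OF cG]
    \<comment> \<open>The conjugate of \<open>c\<close> by \<open>a\<close>. It fixes each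
      \<open>x\<close>, because \<open>x a\<close> is again in Hom(g,f) and hence fixed by
      \<open>c\<close>.\<close>
    let ?d = "Comp C a (Comp C c b)"
    have d: "?d \<in> HomOver C g g"
      using HomOver_Comp gC a b cG by blast
    have "Comp C x ?d = x" if x: "x \<in> HomOver C g f" for x
    proof -
      note X = HomOverD[OF x]
      have "Comp C x a \<in> HomOver C g f" using HomOver_Comp[OF gC(2) a x] .
      then have "Comp C (Comp C x a) c = Comp C x a" using c st by (auto simp: stab_def)
      then have "Comp C x ?d = Comp C (Comp C x a) b"
        using X A B c' by (simp add: Comp_assoc Comp_in_Arr Cod_Comp Dom_Comp)
      also have "\<dots> = x" using X A B b(2) Comp_Ide[of x] by (simp flip: Comp_assoc)
      finally show ?thesis .
    qed
    then have "?d \<in> stab g W" using d st by (auto simp: stab_def)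
    then have "Comp C W ?d = W" by (simp add: stab_def)
    \<comment> \<open>Composing \<open>W ?d = W\<close> with \<open>a\<close> on the right cancels
      \<open>b\<close> and leaves \<open>W a c = W a\<close>.\<close>
    then have "Comp C W a = Comp C (Comp C W ?d) a" by simp
    also have "\<dots> = Comp C (Comp C W a) (Comp C c (Comp C b a))"
      using w A B c' by (simp add: Comp_in_Arr Cod_Comp Dom_Comp Comp_assoc)
    also have "\<dots> = Comp C (Comp C W a) c" using b(3) c' Comp_Ide by metis
    finally show "c \<in> stab g (Comp C W a)" using cG by (simp add: stab_def)
  qed
  then have galh: "galois_cover C D deg h" using normal_stab_galois[OF gal h W] by blast
  have codh: "Cod C h = Cod C g" using w hC Cod_Comp by metis
  have "dominated C f h" using hf cod codh by (simp add: dominated_def)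
  moreover have "dominated C h g" using W codh by (auto simp: dominated_def)
  ultimately have "dominated C g h"
    using cl galh unfolding galois_closure_def by blast
  then obtain v where v: "v \<in> HomOver C h g" by (auto simp: dominated_def)
  have VD: "v \<in> Arr D" "W \<in> Arr D" using HomOver_in_Arr_D h g v W by blast+
  then have "deg h > 0" "deg v > 0" "deg W > 0" using h deg_pos by (auto simp: Arr_D)
  \<comment> \<open>Degrees along the loop from \<open>h\<close> to \<open>g\<close> and back to
    \<open>h\<close>; \<open>deg W\<close> is then the order of the kernel.\<close>
  moreover have "deg h = deg h * deg W * deg v"
    using deg_HomOver[OF g h v] deg_HomOver[OF h g W] by simp
  ultimately have "deg W = 1" by simp
  then have "card ?K = 1" using card_HomOver_galois(2)[OF gal h W] st by simp
  moreover have "Ide C (Dom C g) \<in> ?K"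
    using gC
    by (auto intro!: HomOverI simp: stab_def HomOver_def Ide_in_Arr Dom_Ide Cod_Ide Comp_Ide Dom_in_Obj)
       (metis Comp_Ide)+
  ultimately show ?thesis by (metis card_1_singletonE singletonD)
qed

section \<open>Embedding the automorphisms into permutations\<close>

lemma deg_galois_closure_le:
  assumes cl: "galois_closure C D deg f g" and f: "f \<in> Arr D"
  shows "deg g \<le> fact (deg f)"
proof -
  have gal: "galois_cover C D deg g" and dom: "dominated C f g"
    using cl by (auto simp: galois_closure_def)
  have g: "g \<in> Arr D" using gal by (auto simp: galois_cover_def is_cover_def)
  have gC: "g \<in> Arr C" "f \<in> Arr C" using g f by (auto simp: Arr_D)
  let ?H = "HomOver C g f" and ?G = "HomOver C g g"
  have cod: "Cod C f = Cod C g" using dom by (simp add: dominated_def)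
  have fin: "finite ?H" and cardH: "card ?H \<le> deg f"
    using finite_HomOver_and_card_le[OF f g cod] by auto
  \<comment> \<open>The identity outside Hom(g,f) is required by \<open>permutes\<close>.\<close>
  define act where "act a = (\<lambda>x. if x \<in> ?H then Comp C x a else x)" for a
  have cancel: "Comp C (Comp C x a) b = x"
    if "x \<in> ?H \<or> x \<in> ?G" "a \<in> ?G" "b \<in> ?G" "Comp C a b = Ide C (Dom C g)" for x a b
    using that HomOverD[OF that(2)] HomOverD[OF that(3)]
    by (auto simp: Comp_Ide HomOver_def simp flip: Comp_assoc) (metis Comp_Ide)+
  have perm: "act a permutes ?H" if a: "a \<in> ?G" for a
  proof (rule bij_imp_permutes)
    obtain b where b: "b \<in> ?G" "Comp C a b = Ide C (Dom C g)" using galois_inverse[OF gal a] .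
    have "inj_on (act a) ?H"
      by (rule inj_on_inverseI[where g = "\<lambda>x. Comp C x b"]) (simp add: act_def cancel a b)
    moreover have "act a ` ?H \<subseteq> ?H"
      using HomOver_Comp[OF gC(2) a] by (auto simp: act_def)
    ultimately show "bij_betw (act a) ?H ?H"
      using fin by (simp add: bij_betw_def endo_inj_surj)
  qed (simp add: act_def)
  have inj: "inj_on act ?G"
  proof (rule inj_onI)
    fix a a' assume a: "a \<in> ?G" and a': "a' \<in> ?G" and eq: "act a = act a'"
    obtain b where b: "b \<in> ?G" "Comp C a b = Ide C (Dom C g)" "Comp C b a = Ide C (Dom C g)"
      using galois_inverse[OF gal a] .
    have ab: "Comp C a' b \<in> ?G" using HomOver_Comp[OF gC(1) b(1) a'] .
    \<comment> \<open>If \<open>a\<close> and \<open>a'\<close> act alike, then \<open>a'\<close>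
      composed with the inverse of \<open>a\<close> lies in the kernel.\<close>
    have "Comp C x (Comp C a' b) = x" if x: "x \<in> ?H" for x
    proof -
      have "Comp C x a = Comp C x a'" using fun_cong[OF eq, of x] x by (simp add: act_def)
      then have "Comp C (Comp C x a') b = x" using cancel[of x a b] x a b by simp
      then show ?thesis
        using HomOverD[OF x] HomOverD[OF a'] HomOverD[OF b(1)] by (simp add: Comp_assoc)
    qed
    then have "Comp C a' b \<in> (\<Inter>x\<in>?H. stab g x)" using ab by (auto simp: stab_def)
    then have 1: "Comp C a' b = Ide C (Dom C g)"
      using galois_closure_trivial_kernel[OF cl f] by simp
    have "a' = Comp C (Comp C a' b) a" using cancel[of a' b a] a a' b by simp
    also have "\<dots> = a" using 1 HomOverD[OF a] Ide_Comp by metis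
    finally show "a = a'" by simp
  qed
  have "deg g = card ?G" using Aut_cover_galois(2)[OF gal] by simp
  also have "\<dots> \<le> card {p. p permutes ?H}"
    using card_inj_on_le[OF inj _ finite_permutations[OF fin]] perm by auto
  also have "\<dots> = fact (card ?H)" using card_permutations[OF refl fin] .
  also have "\<dots> \<le> fact (deg f)" using fact_mono[OF cardH] .
  finally show ?thesis .
qed

end

theorem theorem4p9:
  fixes C D :: "('o, 'a) cat"
    and \<Sigma> :: "'o \<Rightarrow> 'a set"
    and deg :: "'a \<Rightarrow> nat"
    and f g :: 'a
  assumes "galois_setting C D \<Sigma> deg"
    and "is_cover D f"
    and "galois_closure C D deg f g"
  shows "deg g \<le> fact (deg f)"
  using galois_setting.deg_galois_closure_le[OF assms(1,3)] assms(2)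
  by (simp add: is_cover_def)

end
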